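(* Let $k\ge 1$, $n\geq 1$, let $\Omega\subset\mathbb{R}^2$ be open and convex, and let $A\in C^k(\Omega,\mathbb{C}^{n\times n})$ have distinct eigenvalues at every point of $\Omega$. Let $\Gamma\subset\Omega$ be a smooth Jordan curve encircling a point $\xi_0\in\Omega$, parametrized by $\gamma$ in such a way that both $\gamma(\cdot)$ and $A(\gamma(\cdot))$ are $1$-periodic. For $s\in(0,1]$ let $\Gamma_s$ be the curve parametrized by $\gamma_s(t)=\xi_0+s(\gamma(t)-\xi_0)$. For each $j=1,\dots,n$, let $\alpha_j(s)$ be the phase (defined modulo $2\pi$) accrued by the eigenvector $v_j$ along $\Gamma_s$. Then, for each $j$, $$\alpha_j(s)=O(s)\pmod{2\pi}\quad\text{as } s\to 0.$$
   Context: "$p$-periodic", when said of $\gamma(\cdot)$ and $A(\gamma(\cdot))$, means that $p$ is the minimal positive period. A smooth Jordan curve is a $C^1$, $1$-periodic map $\gamma:\mathbb{R}\to\mathbb{R}^2$ that is one-to-one on $[0,1)$; its image $\Gamma$ is also called a smooth Jordan curve. $\Gamma$ encircles a point if the point lies in the bounded component of $\mathbb{R}^2\setminus\Gamma$. Parallel-transport eigendecomposition: for a matrix function $B(t)\in\mathbb{C}^{n\times n}$ with distinct eigenvalues for all $t$, consider $B(t)=V(t)\Lambda(t)V^{-1}(t)$ with $V=[v_1,\dots,v_n]$ invertible, $\Lambda=\mathrm{diag}(\lambda_1,\dots,\lambda_n)$, and $V,\Lambda$ continuously differentiable. Put $P(t)=V^{-1}(t)\dot V(t)$. It is a parallel-transport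 eigendecomposition if for all $j$ and $t$: $\mathrm{Re}(v_j^*v_jP_{jj})=-\sum_{l\ne j}\mathrm{Re}(v_j^*v_lP_{lj})$ (equivalently, $\|v_j(t)\|$ is constant in $t$), and $\mathrm{Im}(P_{jj}(t))=0$. Phase accrued: when $A$ has distinct eigenvalues throughout $\Omega$, a parallel-transport eigendecomposition of $A$ along a smooth Jordan curve in $\Omega$ (parametrized with period $1$) satisfies $v_j(t+1)=e^{i\alpha_j}v_j(t)$ for all $t$, with constant $\alpha_j\in\mathbb{R}$; $\alpha_j$ (mod $2\pi$) is called the phase accrued by $v_j$ along the curve. The labels $j$ refer to a fixed labeling of the eigenvalues of $A$ as continuous functions on $\Omega$. "$\alpha(s)=O(s)\pmod{2\pi}$" means that a representative of $\alpha(s)$ modulo $2\pi$ is $O(s)$. *)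

theory Defs
  imports
    "HOL-Analysis.Analysis"
    "HOL-Library.Landau_Symbols"
    "HOL-Library.Real_Mod"
begin

text \<open>The class \<open>C\<^sup>k\<close> on an open set; the directional derivatives in all directions
  include the partial derivatives, and are linear combinations of them.\<close>

fun C_k_on :: "nat \<Rightarrow> ('a::real_normed_vector \<Rightarrow> 'b::real_normed_vector) \<Rightarrow> 'a set \<Rightarrow> bool" where
  "C_k_on 0 f S \<longleftrightarrow> continuous_on S f"
| "C_k_on (Suc k) f S \<longleftrightarrow>
     (\<forall>x\<in>S. f differentiable (at x)) \<and>
     (\<forall>v. C_k_on k (\<lambda>x. frechet_derivative f (at x) v) S)"

definition has_minimal_period :: "(real \<Rightarrow> 'a) \<Rightarrow> real \<Rightarrow> bool" where
  "has_minimal_period f p \<longleftrightarrow>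
     p > 0 \<and> (\<forall>t. f (t + p) = f t) \<and> (\<forall>q. 0 < q \<and> q < p \<longrightarrow> \<not> (\<forall>t. f (t + q) = f t))"

text \<open>\<open>C\<^sup>1\<close> refers to the parametrization only: the velocity is allowed to vanish.\<close>

definition smooth_Jordan_curve :: "(real \<Rightarrow> real^2) \<Rightarrow> bool" where
  "smooth_Jordan_curve \<gamma> \<longleftrightarrow>
     \<gamma> C1_differentiable_on UNIV \<and> has_minimal_period \<gamma> 1 \<and> inj_on \<gamma> {0..<1}"

definition eigenvalues :: "complex^'n^'n \<Rightarrow> complex set" where
  "eigenvalues M = {\<mu>. \<exists>v. v \<noteq> 0 \<and> M *v v = \<mu> *s v}"

definition distinct_eigenvalues :: "complex^'n^'n \<Rightarrow> bool" where
  "distinct_eigenvalues M \<longleftrightarrow> card (eigenvalues M) = CARD('n)"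

definition eigenvalue_labeling ::
  "(real^2 \<Rightarrow> complex^'n^'n) \<Rightarrow> (real^2) set \<Rightarrow> ('n \<Rightarrow> real^2 \<Rightarrow> complex) \<Rightarrow> bool" where
  "eigenvalue_labeling A \<Omega> \<mu> \<longleftrightarrow>
     (\<forall>j. continuous_on \<Omega> (\<mu> j)) \<and>
     (\<forall>\<xi>\<in>\<Omega>. bij_betw (\<lambda>j. \<mu> j \<xi>) UNIV (eigenvalues (A \<xi>)))"

definition diag_matrix :: "complex^'n \<Rightarrow> complex^'n^'n" where
  "diag_matrix d = (\<chi> i j. if i = j then d $ i else 0)"

text \<open>The scalar \<open>v\<^sup>* w\<close>, conjugate-linear in the first argument.\<close>

definition herm :: "complex^'n \<Rightarrow> complex^'n \<Rightarrow> complex" where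
  "herm v w = (\<Sum>i\<in>UNIV. cnj (v $ i) * w $ i)"

definition C1_eigendecomposition ::
  "(real \<Rightarrow> complex^'n^'n) \<Rightarrow> (real \<Rightarrow> complex^'n^'n) \<Rightarrow> (real \<Rightarrow> complex^'n) \<Rightarrow> bool" where
  "C1_eigendecomposition B V \<Lambda> \<longleftrightarrow>
     (\<forall>t. distinct_eigenvalues (B t)) \<and>
     V C1_differentiable_on UNIV \<and> \<Lambda> C1_differentiable_on UNIV \<and>
     (\<forall>t. invertible (V t) \<and> B t = V t ** diag_matrix (\<Lambda> t) ** matrix_inv (V t))"

definition transport_matrix :: "(real \<Rightarrow> complex^'n^'n) \<Rightarrow> real \<Rightarrow> complex^'n^'n" where
  "transport_matrix V t = matrix_inv (V t) ** vector_derivative V (at t)"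

definition parallel_transport_eigendecomposition ::
  "(real \<Rightarrow> complex^'n^'n) \<Rightarrow> (real \<Rightarrow> complex^'n^'n) \<Rightarrow> (real \<Rightarrow> complex^'n) \<Rightarrow> bool" where
  "parallel_transport_eigendecomposition B V \<Lambda> \<longleftrightarrow>
     C1_eigendecomposition B V \<Lambda> \<and>
     (\<forall>j t. let P = transport_matrix V t; v = (\<lambda>l. column l (V t)) in
        Re (herm (v j) (v j) * P $ j $ j) = - (\<Sum>l\<in>UNIV - {j}. Re (herm (v j) (v l) * P $ l $ j)) \<and>
        Im (P $ j $ j) = 0)"

text \<open>\<open>\<alpha>\<close> is a representative, modulo \<open>2\<pi>\<close>, of the phase accrued along the \<open>1\<close>-periodic curve \<open>c\<close>
  by the eigenvector belonging to the \<open>j\<close>-th eigenvalue in the labeling \<open>\<mu>\<close>.\<close>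

definition accrues_phase ::
  "(real^2 \<Rightarrow> complex^'n^'n) \<Rightarrow> ('n \<Rightarrow> real^2 \<Rightarrow> complex) \<Rightarrow> (real \<Rightarrow> real^2) \<Rightarrow> 'n \<Rightarrow> real \<Rightarrow> bool" where
  "accrues_phase A \<mu> c j \<alpha> \<longleftrightarrow>
     (\<exists>V \<Lambda>. parallel_transport_eigendecomposition (\<lambda>t. A (c t)) V \<Lambda> \<and>
        (\<forall>i t. \<Lambda> t $ i = \<mu> i (c t)) \<and>
        (\<forall>t. column j (V (t + 1)) = cis \<alpha> *s column j (V t)))"

definition scaled_curve :: "real^2 \<Rightarrow> (real \<Rightarrow> real^2) \<Rightarrow> real \<Rightarrow> real \<Rightarrow> real^2" where
  "scaled_curve \<xi>\<^sub>0 \<gamma> s t = \<xi>\<^sub>0 + s *\<^sub>R (\<gamma> t - \<xi>\<^sub>0)"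

end

theory Submission
  imports Defs
begin

text \<open>The speed of a parallel-transported eigenvector \<open>v\<^sub>j\<close> along a curve is at most
  \<open>\<bar>T (d/dt A) v\<^sub>j\<bar>\<close>, where \<open>T\<close> is the reduced resolvent of \<open>A\<close> at its \<open>j\<close>-th eigenvalue. Interpolation
  at the eigenvalues exhibits \<open>T\<close> as a polynomial in \<open>A\<close> whose coefficients are continuous on
  \<open>\<Omega>\<close>, so it is bounded on the compact cone over the curve with apex \<open>\<xi>\<^sub>0\<close>. Along the
  curve scaled by \<open>s\<close> the derivative of \<open>A\<close> is \<open>O(s)\<close>, hence over one period \<open>v\<^sub>j\<close> moves by
  \<open>O(s) \<bar>v\<^sub>j\<bar>\<close>, which bounds \<open>\<bar>exp(i \<alpha>\<^sub>j(s)) - 1\<bar>\<close>.\<close>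

section \<open>Chord length on the unit circle, and bilinearity and continuity of matrix
  operations\<close>

text \<open>The chord from 1 to \<open>cis x\<close> has length
  \<open>2 * \<bar>sin (x / 2)\<bar>\<close>, and for half-angles up to pi/2 the Taylor remainder of
  the sine takes away at most half of the linear term. This turns a bound on
  \<open>cis \<alpha> - 1\<close> into a bound on the angle.\<close>

lemma abs_le_norm_cis_minus_one:
  assumes "\<bar>x\<bar> \<le> pi"
  shows "\<bar>x\<bar> \<le> 2 * norm (cis x - 1)"
proof -
  define y where "y = x / 2"
  \<comment> \<open>8/5 is a rational upper bound for pi/2 that is small enough for
    \<open>y^2 / 6 \<le> 1/2\<close>.\<close>
  have y: "\<bar>y\<bar> \<le> 8 / 5"
    using assms pi_approx(2) by (simp add: y_def)
  have "\<bar>sin y - (\<Sum>m<3. sin_coeff m * y ^ m)\<bar> \<le> inverse (fact 3) * \<bar>y\<bar> ^ 3"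
    by (rule Maclaurin_sin_bound)
  then have "\<bar>sin y - y\<bar> \<le> \<bar>y\<bar> * (\<bar>y\<bar>^2 / 6)"
    by (simp add: sin_coeff_def numeral_eq_Suc)
  also have "\<dots> \<le> \<bar>y\<bar> * (1/2)"
  proof (rule mult_left_mono)
    have "\<bar>y\<bar>^2 \<le> (8/5)^2"
      using y by (intro power_mono) auto
    then show "\<bar>y\<bar>^2 / 6 \<le> 1/2"
      by (simp add: power2_eq_square)
  qed simp
  finally have 1: "\<bar>y\<bar> \<le> 2 * \<bar>sin y\<bar>"
    by linarith
  have "cis x - 1 = cis y * (cis y - cis (- y))"
    by (simp add: y_def right_diff_distrib cis_mult)
  also have "cis y - cis (- y) = 2 * \<i> * sin y"
    by (simp add: complex_eq_iff)
  finally have "norm (cis x - 1) = 2 * \<bar>sin y\<bar>"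
    by (simp add: norm_mult)
  with 1 show ?thesis
    by (simp add: y_def)
qed

lemma norm_vector_smult: "norm (c *s x) = norm c * norm x"
  for x :: "'a::real_normed_field ^ 'n"
  by (simp add: norm_vec_def norm_mult L2_set_right_distrib)

text \<open>Serves as product rule for \<open>B t *v v t\<close>, as linearity in either factor, and
  as norm estimate. The constant is crude, since only its existence matters.\<close>

lemma bounded_bilinear_matrix_vector_mult:
  "bounded_bilinear ((*v) :: complex^'n^'m \<Rightarrow> complex^'n \<Rightarrow> complex^'m)"
proof
  show "\<exists>K. \<forall>(M :: complex^'n^'m) x. norm (M *v x) \<le> norm M * norm x * K"
  proof (intro exI allI)
    fix M :: "complex^'n^'m" and x
    have "norm (M *v x) \<le> (\<Sum>i\<in>UNIV. norm ((M *v x) $ i))"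
      by (simp add: norm_vec_def L2_set_le_sum)
    also have "\<dots> \<le> (\<Sum>i\<in>(UNIV::'m set). \<Sum>j\<in>(UNIV::'n set). norm M * norm x)"
    proof (rule sum_mono)
      fix i
      have "norm ((M *v x) $ i) \<le> (\<Sum>j\<in>UNIV. norm (M $ i $ j) * norm (x $ j))"
        unfolding matrix_vector_mult_def by (auto intro!: sum_norm_le simp: norm_mult)
      also have "\<dots> \<le> (\<Sum>j\<in>(UNIV::'n set). norm M * norm x)"
        by (intro sum_mono mult_mono Finite_Cartesian_Product.norm_nth_le order_trans[OF Finite_Cartesian_Product.norm_nth_le[of "M $ i"]]) auto
      finally show "norm ((M *v x) $ i) \<le> (\<Sum>j\<in>(UNIV::'n set). norm M * norm x)" .
    qed
    also have "\<dots> = norm M * norm x * (CARD('m) * CARD('n))"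
      by simp
    finally show "norm (M *v x) \<le> norm M * norm x * (CARD('m) * CARD('n))" .
  qed
qed (simp_all add: matrix_vector_mult_def vec_eq_iff algebra_simps sum.distrib scaleR_sum_right)

lemma bounded_bilinear_vector_smult:
  "bounded_bilinear ((*s) :: complex \<Rightarrow> complex^'n \<Rightarrow> complex^'n)"
proof
  show "\<exists>K. \<forall>(c::complex) (x::complex^'n). norm (c *s x) \<le> norm c * norm x * K"
    by (rule exI[of _ 1]) (simp add: norm_vector_smult)
qed (simp_all add: vec_eq_iff algebra_simps)

lemma bounded_linear_column: "bounded_linear (column j :: complex^'n^'m \<Rightarrow> complex^'m)"
  by (rule linear_conv_bounded_linear[THEN iffD1], rule linearI)
     (simp_all add: column_def vec_eq_iff)

text \<open>Links the normalization of parallel transport, stated with \<open>herm\<close>, to the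
  real inner product in which orthogonality and norms are handled.\<close>

lemma Re_herm_eq_inner: "Re (herm v w) = v \<bullet> w"
  by (simp add: herm_def inner_vec_def inner_complex_def)

lemma frechet_derivative_eq_sum_Basis:
  fixes f :: "'a::euclidean_space \<Rightarrow> 'b::real_normed_vector"
  assumes "f differentiable (at x)"
  shows "frechet_derivative f (at x) h = (\<Sum>b\<in>Basis. (h \<bullet> b) *\<^sub>R frechet_derivative f (at x) b)"
proof -
  have "linear (frechet_derivative f (at x))"
    using assms by (rule linear_frechet_derivative)
  then show ?thesis
    using linear_sum[of "frechet_derivative f (at x)" "\<lambda>b. (h \<bullet> b) *\<^sub>R b" Basis]
    by (simp add: euclidean_representation linear_scale)
qed

lemma C_k_on_imp_continuous_on: "C_k_on k f S \<Longrightarrow> continuous_on S f"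
  by (cases k) (auto intro!: continuous_at_imp_continuous_on differentiable_imp_continuous_within)

lemma continuous_on_mat [continuous_intros]:
  "continuous_on S f \<Longrightarrow> continuous_on S (\<lambda>x. mat (f x) :: 'a::real_normed_vector^'n^'n)"
  unfolding mat_def
proof (intro continuous_on_vec_lambda)
  fix i j :: 'n
  assume "continuous_on S f"
  then show "continuous_on S (\<lambda>x. if i = j then f x else 0)"
    by (cases "i = j") auto
qed

lemma continuous_on_matrix_matrix_mult [continuous_intros]:
  fixes f :: "'a::topological_space \<Rightarrow> 'b::real_normed_algebra_1^'n^'m"
  assumes "continuous_on S f" "continuous_on S g"
  shows "continuous_on S (\<lambda>x. f x ** g x)"
  unfolding matrix_matrix_mult_def
  by (intro continuous_on_vec_lambda continuous_intros assms)

lemma mat_vector_mult: "mat c *v x = c *s x"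
  for x :: "'a::semiring_1^'n"
  by (simp add: vec_eq_iff matrix_vector_mult_def mat_def if_distrib if_distribR cong: if_cong)

section \<open>Interpolation at the eigenvalues, continuous in the parameter\<close>

text \<open>\<open>F\<close> is the product of the matrices
  \<open>M \<xi> - mat (\<mu> m \<xi>)\<close> over \<open>J\<close>. Each factor multiplies an
  eigenvector for \<open>\<mu> i \<xi>\<close> by \<open>\<mu> i \<xi> - \<mu> m \<xi>\<close>. Only
  this action is recorded, as it is all that interpolation uses.\<close>

lemma continuous_on_annihilator:
  fixes M :: "'a::topological_space \<Rightarrow> complex^'n^'n"
  assumes "continuous_on S M" "\<And>i. continuous_on S (\<mu> i)" "finite J"
  shows "\<exists>F. continuous_on S F \<and> (\<forall>\<xi>\<in>S. \<forall>i x. M \<xi> *v x = \<mu> i \<xi> *s x \<longrightarrow>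
      F \<xi> *v x = (\<Prod>m\<in>J. \<mu> i \<xi> - \<mu> m \<xi>) *s x)"
  using assms(3)
proof (induction J)
  case empty
  show ?case
    by (rule exI[of _ "\<lambda>_. mat 1"]) auto
next
  case (insert m J)
  then obtain F where F: "continuous_on S F"
    "\<And>\<xi> i x. \<xi> \<in> S \<Longrightarrow> M \<xi> *v x = \<mu> i \<xi> *s x \<Longrightarrow> F \<xi> *v x = (\<Prod>m\<in>J. \<mu> i \<xi> - \<mu> m \<xi>) *s x"
    by blast
  show ?case
  proof (intro exI[of _ "\<lambda>\<xi>. F \<xi> ** (M \<xi> - mat (\<mu> m \<xi>))"] conjI ballI allI impI)
    show "continuous_on S (\<lambda>\<xi>. F \<xi> ** (M \<xi> - mat (\<mu> m \<xi>)))"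
      by (intro continuous_intros F(1) assms)
  next
    fix \<xi> i x assume x: "\<xi> \<in> S" "M \<xi> *v x = \<mu> i \<xi> *s x"
    have "(F \<xi> ** (M \<xi> - mat (\<mu> m \<xi>))) *v x = F \<xi> *v ((\<mu> i \<xi> - \<mu> m \<xi>) *s x)"
      using x by (simp add: matrix_vector_mul_assoc[symmetric] matrix_vector_mult_diff_rdistrib
          vector_sub_rdistrib mat_vector_mult)
    also have "\<dots> = (\<mu> i \<xi> - \<mu> m \<xi>) *s (F \<xi> *v x)"
      by (rule vector_scalar_commute)
    also have "\<dots> = (\<Prod>m\<in>insert m J. \<mu> i \<xi> - \<mu> m \<xi>) *s x"
      using insert.hyps F(2)[OF x] by simp
    finally show "(F \<xi> ** (M \<xi> - mat (\<mu> m \<xi>))) *v x = (\<Prod>m\<in>insert m J. \<mu> i \<xi> - \<mu> m \<xi>) *s x" .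
  qed
qed

text \<open>Lagrange interpolation. The product \<open>F l\<close> over all indices but
  \<open>l\<close> kills the eigenvectors of every other eigenvalue and multiplies those of the
  \<open>l\<close>-th by \<open>p l\<close>. Injectivity keeps \<open>p l\<close> away from zero, so
  \<open>T\<close>, the sum of the \<open>F l\<close> weighted by \<open>f l / p l\<close>, is
  continuous and has the prescribed eigenvalues.\<close>

lemma continuous_on_interpolation:
  fixes M :: "'a::topological_space \<Rightarrow> complex^'n^'n" and \<mu> f :: "'n \<Rightarrow> 'a \<Rightarrow> complex"
  assumes M: "continuous_on S M" and \<mu>: "\<And>i. continuous_on S (\<mu> i)"
    and f: "\<And>i. continuous_on S (f i)"
    and inj: "\<And>\<xi>. \<xi> \<in> S \<Longrightarrow> inj (\<lambda>i. \<mu> i \<xi>)"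
  obtains T where "continuous_on S T"
    "\<And>\<xi> i x. \<xi> \<in> S \<Longrightarrow> M \<xi> *v x = \<mu> i \<xi> *s x \<Longrightarrow> T \<xi> *v x = f i \<xi> *s x"
proof -
  have "\<exists>F. continuous_on S F \<and> (\<forall>\<xi>\<in>S. \<forall>i x. M \<xi> *v x = \<mu> i \<xi> *s x \<longrightarrow>
      F \<xi> *v x = (\<Prod>m\<in>UNIV - {l}. \<mu> i \<xi> - \<mu> m \<xi>) *s x)" for l
    by (rule continuous_on_annihilator[OF M \<mu>]) simp
  then obtain F where F: "\<And>l. continuous_on S (F l)"
    "\<And>l \<xi> i x. \<xi> \<in> S \<Longrightarrow> M \<xi> *v x = \<mu> i \<xi> *s x \<Longrightarrow>
      F l \<xi> *v x = (\<Prod>m\<in>UNIV - {l}. \<mu> i \<xi> - \<mu> m \<xi>) *s x"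
    by metis
  define p where "p l \<xi> = (\<Prod>m\<in>UNIV - {l}. \<mu> l \<xi> - \<mu> m \<xi>)" for l \<xi>
  have p: "p l \<xi> \<noteq> 0" if "\<xi> \<in> S" for l \<xi>
    using inj[OF that] by (auto simp: p_def inj_def)
  define T where "T \<xi> = (\<Sum>l\<in>UNIV. mat (f l \<xi> / p l \<xi>) ** F l \<xi>)" for \<xi>
  show thesis
  proof
    have "continuous_on S (p l)" for l
      unfolding p_def by (intro continuous_intros \<mu>)
    then show "continuous_on S T"
      unfolding T_def using p by (intro continuous_intros F(1) f) auto
  next
    fix \<xi> i x assume x: "\<xi> \<in> S" "M \<xi> *v x = \<mu> i \<xi> *s x"
    have "T \<xi> *v x = (\<Sum>l\<in>UNIV. (mat (f l \<xi> / p l \<xi>) ** F l \<xi>) *v x)"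
      unfolding T_def
      by (rule linear_sum[OF bounded_linear.linear, OF bounded_bilinear.bounded_linear_left[OF bounded_bilinear_matrix_vector_mult]])
    also have "\<dots> = (\<Sum>l\<in>UNIV. if l = i then f i \<xi> *s x else 0)"
    proof (rule sum.cong[OF refl])
      fix l
      have "(mat (f l \<xi> / p l \<xi>) ** F l \<xi>) *v x
          = (f l \<xi> / p l \<xi> * (\<Prod>m\<in>UNIV - {l}. \<mu> i \<xi> - \<mu> m \<xi>)) *s x"
        using F(2)[OF x] by (simp add: matrix_vector_mul_assoc[symmetric] mat_vector_mult)
      also have "\<dots> = (if l = i then f i \<xi> *s x else 0)"
      proof (cases "l = i")
        case True
        then show ?thesis
          using p[OF x(1), of i] by (simp add: p_def)
      next
        case False
        then have "(\<Prod>m\<in>UNIV - {l}. \<mu> i \<xi> - \<mu> m \<xi>) = 0"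
          by (intro prod_zero) auto
        with False show ?thesis
          by simp
      qed
      finally show "(mat (f l \<xi> / p l \<xi>) ** F l \<xi>) *v x = (if l = i then f i \<xi> *s x else 0)" .
    qed
    finally show "T \<xi> *v x = f i \<xi> *s x"
      by simp
  qed
qed

section \<open>Uniform bound on the derivative over a compact set\<close>

text \<open>\<open>C_k_on\<close> gives continuity of the derivative in one fixed direction at a
  time. Compactness bounds it for each of the finitely many basis directions, and linearity extends
  the bound to all \<open>h\<close>.\<close>

lemma C_k_on_frechet_derivative_bounded:
  fixes f :: "'a::euclidean_space \<Rightarrow> 'b::real_normed_vector"
  assumes f: "C_k_on (Suc k) f S" and K: "compact K" "K \<subseteq> S"
  shows "\<exists>C. \<forall>x\<in>K. \<forall>h. norm (frechet_derivative f (at x) h) \<le> C * norm h"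
proof -
  have "bounded ((\<lambda>x. frechet_derivative f (at x) b) ` K)" for b
  proof (rule compact_imp_bounded, rule compact_continuous_image[OF _ K(1)])
    have "C_k_on k (\<lambda>x. frechet_derivative f (at x) b) S"
      using f by simp
    then show "continuous_on K (\<lambda>x. frechet_derivative f (at x) b)"
      using K(2) C_k_on_imp_continuous_on continuous_on_subset by blast
  qed
  then have "\<exists>C. \<forall>x\<in>K. norm (frechet_derivative f (at x) b) \<le> C" for b
    by (auto simp: bounded_iff)
  then obtain C where C: "\<And>b x. x \<in> K \<Longrightarrow> norm (frechet_derivative f (at x) b) \<le> C b"
    by metis
  have "norm (frechet_derivative f (at x) h) \<le> (\<Sum>b\<in>Basis. C b) * norm h" if x: "x \<in> K" for x h
  proof -
    have "f differentiable (at x)"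
      using f K(2) x by auto
    then have "norm (frechet_derivative f (at x) h)
        \<le> (\<Sum>b\<in>Basis. norm ((h \<bullet> b) *\<^sub>R frechet_derivative f (at x) b))"
      by (subst frechet_derivative_eq_sum_Basis) (auto simp del: norm_scaleR intro: norm_sum)
    also have "\<dots> \<le> (\<Sum>b\<in>Basis. norm h * C b)"
      unfolding norm_scaleR by (intro sum_mono mult_mono Basis_le_norm C[OF x]) auto
    finally show ?thesis
      by (simp add: sum_distrib_left mult.commute)
  qed
  then show ?thesis
    by blast
qed

section \<open>Columns of an eigendecomposition and their derivatives\<close>

lemma matrix_vector_mult_axis: "M *v axis l 1 = column l M"
  for M :: "'a::semiring_1^'n^'m"
  by (simp add: vec_eq_iff matrix_vector_mult_def axis_def column_def if_distrib cong: if_cong)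

lemma matrix_inv_left_right:
  assumes "invertible M"
  shows "matrix_inv M ** M = mat 1" "M ** matrix_inv M = mat 1"
  using assms unfolding invertible_def matrix_inv_def
  by (rule someI2_ex, blast)+

text \<open>Written as \<open>V *v axis l 1\<close>, the column cancels the inverse of
  \<open>V\<close>, and the axis vector is an eigenvector of the diagonal factor.\<close>

lemma eigendecomposition_column:
  assumes "invertible V" "B = V ** diag_matrix d ** matrix_inv V"
  shows "B *v column l V = d $ l *s column l V"
proof -
  have "B *v column l V = (V ** diag_matrix d ** (matrix_inv V ** V)) *v axis l 1"
    by (simp add: assms(2) matrix_vector_mult_axis[symmetric] matrix_vector_mul_assoc matrix_mul_assoc)
  also have "\<dots> = V *v (diag_matrix d *v axis l 1)"
    by (simp add: matrix_inv_left_right assms(1) matrix_vector_mul_assoc)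
  also have "diag_matrix d *v axis l 1 = d $ l *s axis l 1"
    unfolding matrix_vector_mult_axis by (auto simp: vec_eq_iff diag_matrix_def axis_def column_def)
  also have "V *v \<dots> = d $ l *s column l V"
    by (simp only: vector_scalar_commute matrix_vector_mult_axis)
  finally show ?thesis .
qed

text \<open>Differentiating \<open>B v\<^sub>j = \<lambda>\<^sub>j v\<^sub>j\<close> and applying the reduced resolvent \<open>T\<close> recovers the part
  \<open>r = \<Sum>l\<noteq>j. P\<^sub>l\<^sub>j v\<^sub>l\<close> of \<open>v\<^sub>j'\<close>. The rest \<open>P\<^sub>j\<^sub>j v\<^sub>j\<close> is a real multiple of \<open>v\<^sub>j\<close>, so orthogonality
  of \<open>v\<^sub>j'\<close> and \<open>v\<^sub>j\<close> gives \<open>\<bar>v\<^sub>j'\<bar>\<^sup>2 = v\<^sub>j' \<bullet> r\<close>.\<close>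

lemma parallel_transport_column_derivative:
  fixes V :: "real \<Rightarrow> complex^'n^'n"
  assumes pt: "parallel_transport_eigendecomposition B V \<Lambda>"
    and B': "(B has_vector_derivative B') (at t)"
    and Tj: "T *v column j (V t) = 0"
    and T: "\<And>l. l \<noteq> j \<Longrightarrow> (\<Lambda> t $ j - \<Lambda> t $ l) *s (T *v column l (V t)) = column l (V t)"
  obtains v' where "((\<lambda>t. column j (V t)) has_vector_derivative v') (at t)"
    "column j (V t) \<bullet> v' = 0" "norm v' \<le> norm (T *v (B' *v column j (V t)))"
proof -
  note mv = bounded_bilinear_matrix_vector_mult
  define v where "v l \<tau> = column l (V \<tau>)" for l \<tau>
  define P where "P = transport_matrix V t"
  define v' where "v' = column j (vector_derivative V (at t))"
  define r where "r = (\<Sum>l\<in>UNIV - {j}. P $ l $ j *s v l t)"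
  have ed: "C1_eigendecomposition B V \<Lambda>"
    using pt by (simp add: parallel_transport_eigendecomposition_def)
  have eig: "B \<tau> *v v l \<tau> = \<Lambda> \<tau> $ l *s v l \<tau>" for l \<tau>
    using ed unfolding C1_eigendecomposition_def v_def by (metis eigendecomposition_column)
  have "(V has_vector_derivative vector_derivative V (at t)) (at t)"
    using ed by (auto simp: C1_eigendecomposition_def C1_differentiable_on_eq vector_derivative_works)
  then have v': "(v j has_vector_derivative v') (at t)"
    unfolding v_def v'_def by (rule bounded_linear.has_vector_derivative[OF bounded_linear_column])
  have "(\<Lambda> has_vector_derivative vector_derivative \<Lambda> (at t)) (at t)"
    using ed by (auto simp: C1_eigendecomposition_def C1_differentiable_on_eq vector_derivative_works)
  then obtain d where d: "((\<lambda>\<tau>. \<Lambda> \<tau> $ j) has_vector_derivative d) (at t)"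
    using bounded_linear.has_vector_derivative[OF bounded_linear_vec_nth] by blast
  \<comment> \<open>Column \<open>j\<close> of this identity expands \<open>v'\<close> in the
    eigenvectors \<open>v l t\<close> with coefficients \<open>P $ l $ j\<close>.\<close>
  have "vector_derivative V (at t) = V t ** P"
    using ed by (simp add: P_def transport_matrix_def matrix_mul_assoc matrix_inv_left_right C1_eigendecomposition_def)
  then have "v' = V t *v column j P"
    by (simp add: v'_def matrix_vector_mult_axis[symmetric] matrix_vector_mul_assoc)
  then have v'_sum: "v' = (\<Sum>l\<in>UNIV. P $ l $ j *s v l t)"
    by (simp add: matrix_mult_sum v_def column_def)
  then have v'_r: "v' = P $ j $ j *s v j t + r"
    by (simp add: r_def sum.remove[of UNIV j])

  have "((\<lambda>\<tau>. B \<tau> *v v j \<tau>) has_vector_derivative (B t *v v' + B' *v v j t)) (at t)"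
    by (rule bounded_bilinear.has_vector_derivative[OF mv B' v'])
  moreover have "((\<lambda>\<tau>. B \<tau> *v v j \<tau>) has_vector_derivative (\<Lambda> t $ j *s v' + d *s v j t)) (at t)"
    unfolding eig by (rule bounded_bilinear.has_vector_derivative[OF bounded_bilinear_vector_smult d v'])
  ultimately have "B t *v v' + B' *v v j t = \<Lambda> t $ j *s v' + d *s v j t"
    by (rule vector_derivative_unique_at)
  \<comment> \<open>Since \<open>T\<close> annihilates \<open>v j t\<close>, applying it removes the
    unknown derivative \<open>d\<close> of the eigenvalue.\<close>
  then have "T *v (B t *v v' + B' *v v j t) = T *v (\<Lambda> t $ j *s v' + d *s v j t)"
    by simp
  then have "T *v (B' *v v j t) = \<Lambda> t $ j *s (T *v v') - T *v (B t *v v')"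
    using Tj by (simp add: matrix_vector_right_distrib vector_scalar_commute v_def algebra_simps)
  also have "\<dots> = (\<Sum>l\<in>UNIV. P $ l $ j *s ((\<Lambda> t $ j - \<Lambda> t $ l) *s (T *v v l t)))"
  proof -
    have sum: "M *v (\<Sum>l\<in>UNIV. x l) = (\<Sum>l\<in>UNIV. M *v x l)" for M :: "complex^'n^'n" and x :: "'n \<Rightarrow> _"
      by (rule linear_sum[OF bounded_linear.linear, OF bounded_bilinear.bounded_linear_right[OF mv]])
    show ?thesis
      unfolding v'_sum sum vector_scalar_commute eig
      by (simp add: vec_eq_iff sum_subtractf[symmetric] sum_distrib_left algebra_simps)
  qed
  \<comment> \<open>For \<open>l \<noteq> j\<close>, \<open>T\<close> cancels the eigenvalue gap;
    the term \<open>l = j\<close> vanishes.\<close>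
  also have "\<dots> = r"
    unfolding r_def
  proof (rule sum.mono_neutral_cong_right)
    show "P $ l $ j *s ((\<Lambda> t $ j - \<Lambda> t $ l) *s (T *v v l t)) = P $ l $ j *s v l t"
      if "l \<in> UNIV - {j}" for l
    proof -
      have "l \<noteq> j"
        using that by simp
      show ?thesis
        unfolding v_def T[OF \<open>l \<noteq> j\<close>] ..
    qed
  qed (auto simp: Tj v_def)
  finally have r: "r = T *v (B' *v v j t)"
    by simp

  have pt': "Re (herm (v j t) (v j t) * P $ j $ j) = - (\<Sum>l\<in>UNIV - {j}. Re (herm (v j t) (v l t) * P $ l $ j))"
    "Im (P $ j $ j) = 0"
    using pt unfolding parallel_transport_eigendecomposition_def P_def v_def Let_def by blast+
  \<comment> \<open>With its \<open>j\<close>-th term moved to the other side, the normalization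
    condition says that the real part of this sum is zero.\<close>
  have "herm (v j t) v' = (\<Sum>l\<in>UNIV. herm (v j t) (v l t) * P $ l $ j)"
    unfolding v'_sum herm_def sum_component vector_smult_component sum_distrib_left sum_distrib_right
    by (subst sum.swap) (simp add: mult_ac)
  then have "v j t \<bullet> v' = (\<Sum>l\<in>UNIV. Re (herm (v j t) (v l t) * P $ l $ j))"
    by (simp flip: Re_herm_eq_inner)
  also have "\<dots> = 0"
    using pt'(1) by (simp add: sum.remove[of UNIV j])
  finally have orth: "v j t \<bullet> v' = 0" .
  \<comment> \<open>Only the real inner product of \<open>v j t\<close> and \<open>v'\<close> is
    known to vanish, and it would not rule out an imaginary multiple of \<open>v j t\<close>; hence
    the condition on \<open>Im (P $ j $ j)\<close>.\<close>
  have "P $ j $ j *s v j t = Re (P $ j $ j) *\<^sub>R v j t"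
    using pt'(2) by (simp add: vec_eq_iff complex_eq_iff)
  then have "v' \<bullet> v' = v' \<bullet> r"
    using orth by (subst (2) v'_r) (simp add: inner_add_right inner_commute)
  then have "norm v' * norm v' \<le> norm v' * norm r"
    using norm_cauchy_schwarz[of v' r] by (simp add: dot_square_norm power2_eq_square)
  then have "norm v' \<le> norm r"
    by (cases "norm v' = 0") auto
  with v' orth show thesis
    unfolding r v_def by (rule that)
qed

section \<open>Displacement over one period and the phase\<close>

text \<open>Orthogonality makes \<open>v t \<bullet> v t\<close> constant, so the relative speed
  bound becomes the uniform bound \<open>C * norm (v a)\<close>, and the mean value inequality
  applies.\<close>

lemma norm_increment_le_of_orthogonal_derivative:
  fixes v :: "real \<Rightarrow> 'a::real_inner"
  assumes v': "\<And>t. t \<in> {a..b} \<Longrightarrow> (v has_vector_derivative v' t) (at t)"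
    and orth: "\<And>t. t \<in> {a..b} \<Longrightarrow> v t \<bullet> v' t = 0"
    and bound: "\<And>t. t \<in> {a..b} \<Longrightarrow> norm (v' t) \<le> C * norm (v t)"
    and "a \<le> b"
  shows "norm (v b - v a) \<le> C * norm (v a) * (b - a)"
proof -
  have v'_within: "(v has_vector_derivative v' t) (at t within {a..b})" if "t \<in> {a..b}" for t
    using v'[OF that] by (rule has_vector_derivative_at_within)
  have "((\<lambda>t. v t \<bullet> v t) has_derivative (\<lambda>h. 0)) (at t within {a..b})" if "t \<in> {a..b}" for t
  proof -
    have "((\<lambda>t. v t \<bullet> v t) has_vector_derivative (v t \<bullet> v' t + v' t \<bullet> v t)) (at t within {a..b})"
      by (rule bounded_bilinear.has_vector_derivative[OF bounded_bilinear_inner v'_within[OF that] v'_within[OF that]])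
    then show ?thesis
      using orth[OF that] by (simp add: inner_commute has_vector_derivative_def)
  qed
  then have const: "v t \<bullet> v t = v a \<bullet> v a" if "t \<in> {a..b}" for t
    using that \<open>a \<le> b\<close>
    by (intro has_derivative_zero_unique[of "{a..b}" "\<lambda>t. v t \<bullet> v t"]) auto
  have "norm (v b - v a) \<le> C * norm (v a) * norm (b - a)"
  proof (rule differentiable_bound[where S = "{a..b}" and f' = "\<lambda>t h. h *\<^sub>R v' t"])
    show "(v has_derivative (\<lambda>h. h *\<^sub>R v' t)) (at t within {a..b})" if "t \<in> {a..b}" for t
      using v'_within[OF that] by (simp only: has_vector_derivative_def)
    show "onorm (\<lambda>h. h *\<^sub>R v' t) \<le> C * norm (v a)" if t: "t \<in> {a..b}" for t
    proof (rule onorm_le)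
      fix h :: real
      have "norm (v t) = norm (v a)"
        using const[OF t] by (simp only: norm_eq_sqrt_inner)
      then have "norm (v' t) \<le> C * norm (v a)"
        using bound[OF t] by simp
      then show "norm (h *\<^sub>R v' t) \<le> C * norm (v a) * norm h"
        using mult_right_mono[of "norm (v' t)" "C * norm (v a)" "norm h"]
        by (simp add: mult.commute)
    qed
    show "b \<in> {a..b}" "a \<in> {a..b}"
      using \<open>a \<le> b\<close> by simp_all
  qed (rule convex_real_interval)
  then show ?thesis
    using \<open>a \<le> b\<close> by simp
qed

text \<open>Over one period the eigenvector moves by \<open>cis \<alpha> - 1\<close> times its
  initial value, while its speed is at most \<open>C\<close> times its constant length. Here
  \<open>T t\<close> is the reduced resolvent, specified by its action on eigenvectors.\<close>

lemma norm_cis_accrued_phase_minus_one_le: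
  assumes acc: "accrues_phase A \<mu> c j \<alpha>"
    and B': "\<And>t. t \<in> {0..1} \<Longrightarrow> ((\<lambda>t. A (c t)) has_vector_derivative B' t) (at t)"
    and \<mu>: "\<And>t l. t \<in> {0..1} \<Longrightarrow> l \<noteq> j \<Longrightarrow> \<mu> l (c t) \<noteq> \<mu> j (c t)"
    and T: "\<And>t l x. t \<in> {0..1} \<Longrightarrow> A (c t) *v x = \<mu> l (c t) *s x \<Longrightarrow>
       T t *v x = (if l = j then 0 else inverse (\<mu> j (c t) - \<mu> l (c t))) *s x"
    and bound: "\<And>t x. t \<in> {0..1} \<Longrightarrow> norm (T t *v (B' t *v x)) \<le> C * norm x"
  shows "norm (cis \<alpha> - 1) \<le> C"
proof -
  obtain V \<Lambda> where pt: "parallel_transport_eigendecomposition (\<lambda>t. A (c t)) V \<Lambda>"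
    and \<Lambda>: "\<And>i t. \<Lambda> t $ i = \<mu> i (c t)"
    and \<alpha>: "\<And>t. column j (V (t + 1)) = cis \<alpha> *s column j (V t)"
    using acc by (auto simp: accrues_phase_def)
  have V: "invertible (V t)" "A (c t) = V t ** diag_matrix (\<Lambda> t) ** matrix_inv (V t)" for t
    using pt by (auto simp: parallel_transport_eigendecomposition_def C1_eigendecomposition_def)
  have T_column: "T t *v column l (V t)
      = (if l = j then 0 else inverse (\<mu> j (c t) - \<mu> l (c t))) *s column l (V t)" if "t \<in> {0..1}" for t l
    using T[OF that] eigendecomposition_column[OF V, of t l] by (simp add: \<Lambda>)
  have "\<exists>v'. ((\<lambda>t. column j (V t)) has_vector_derivative v') (at t) \<and> column j (V t) \<bullet> v' = 0 \<and>
      norm v' \<le> C * norm (column j (V t))" if t: "t \<in> {0..1}" for t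
  proof (rule parallel_transport_column_derivative[OF pt B'[OF t], of "T t" j])
    show "T t *v column j (V t) = 0"
      by (simp add: T_column[OF t])
    show "(\<Lambda> t $ j - \<Lambda> t $ l) *s (T t *v column l (V t)) = column l (V t)" if "l \<noteq> j" for l
      using that \<mu>[OF t that] by (simp add: T_column[OF t] \<Lambda> vector_smult_assoc)
  qed (use bound[OF t] order_trans in blast)
  then obtain v' where "\<And>t. t \<in> {0..1} \<Longrightarrow> ((\<lambda>t. column j (V t)) has_vector_derivative v' t) (at t)"
    "\<And>t. t \<in> {0..1} \<Longrightarrow> column j (V t) \<bullet> v' t = 0"
    "\<And>t. t \<in> {0..1} \<Longrightarrow> norm (v' t) \<le> C * norm (column j (V t))"
    by metis
  then have "norm (column j (V 1) - column j (V 0)) \<le> C * norm (column j (V 0)) * (1 - 0)"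
    by (rule norm_increment_le_of_orthogonal_derivative) auto
  moreover have "column j (V 1) - column j (V 0) = (cis \<alpha> - 1) *s column j (V 0)"
    using \<alpha>[of 0] by (simp add: vector_sub_rdistrib)
  ultimately have "norm (cis \<alpha> - 1) * norm (column j (V 0)) \<le> C * norm (column j (V 0))"
    by (metis norm_vector_smult diff_zero mult.right_neutral)
  \<comment> \<open>Needed to divide by the norm; an invertible matrix has no zero column.\<close>
  moreover have "column j (V 0) \<noteq> 0"
  proof
    assume "column j (V 0) = 0"
    then have "matrix_inv (V 0) *v (V 0 *v axis j 1) = 0"
      by (simp add: matrix_vector_mult_axis)
    then show False
      using V(1)[of 0] by (simp add: matrix_vector_mul_assoc matrix_inv_left_right)
  qed
  ultimately show ?thesis
    by simp
qed

section \<open>Uniform estimates on the cone and the choice of representative\<close>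

theorem theorem2p21:
  fixes k :: nat
    and \<Omega> :: "(real^2) set"
    and A :: "real^2 \<Rightarrow> complex^'n^'n"
    and \<gamma> :: "real \<Rightarrow> real^2"
    and \<xi>\<^sub>0 :: "real^2"
    and \<mu> :: "'n \<Rightarrow> real^2 \<Rightarrow> complex"
    and \<alpha> :: "'n \<Rightarrow> real \<Rightarrow> real"
  assumes "k \<ge> 1"
    and "open \<Omega>" and "convex \<Omega>"
    and "C_k_on k A \<Omega>"
    and "\<forall>\<xi>\<in>\<Omega>. distinct_eigenvalues (A \<xi>)"
    and "eigenvalue_labeling A \<Omega> \<mu>"
    and "smooth_Jordan_curve \<gamma>" and "range \<gamma> \<subseteq> \<Omega>"
    and "has_minimal_period (\<lambda>t. A (\<gamma> t)) 1"
    and "\<xi>\<^sub>0 \<in> \<Omega>" and "\<xi>\<^sub>0 \<in> inside (range \<gamma>)"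
    and "\<forall>j. \<forall>s\<in>{0<..1}. accrues_phase A \<mu> (scaled_curve \<xi>\<^sub>0 \<gamma> s) j (\<alpha> j s)"
  shows "\<forall>j. \<exists>\<beta>::real \<Rightarrow> real.
           (\<forall>s\<in>{0<..1}. [\<beta> s = \<alpha> j s] (rmod (2 * pi))) \<and>
           \<beta> \<in> O[at_right 0](\<lambda>s. s)"
proof
  fix j
  obtain m where k: "k = Suc m"
    using assms(1) by (cases k) auto
  obtain \<gamma>' where \<gamma>': "\<And>t. (\<gamma> has_vector_derivative \<gamma>' t) (at t)" "continuous_on UNIV \<gamma>'"
    using assms(7) by (auto simp: smooth_Jordan_curve_def C1_differentiable_on_def)
  then have \<gamma>: "continuous_on UNIV \<gamma>"
    by (meson continuous_at_imp_continuous_on has_vector_derivative_continuous)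
  \<comment> \<open>The cone over the curve, with the apex \<open>s = 0\<close> included: it is
    compact and contains every scaled curve, so bounds on it are uniform as \<open>s\<close> tends
    to 0.\<close>
  define K where "K = (\<lambda>(s, t). scaled_curve \<xi>\<^sub>0 \<gamma> s t) ` ({0..1} \<times> {0..1})"
  have K: "scaled_curve \<xi>\<^sub>0 \<gamma> s t \<in> K" if "s \<in> {0..1}" "t \<in> {0..1}" for s t
    using that by (auto simp: K_def)
  have "continuous_on ({0..1} \<times> {0..1}) (\<lambda>(s, t). scaled_curve \<xi>\<^sub>0 \<gamma> s t)"
    unfolding scaled_curve_def case_prod_beta
    by (intro continuous_intros continuous_on_compose2[OF \<gamma>]) auto
  then have "compact K"
    unfolding K_def by (intro compact_continuous_image compact_Times compact_Icc)
  \<comment> \<open>Each point of the cone is a convex combination of \<open>\<xi>\<^sub>0\<close>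
    and a point of the curve.\<close>
  have "scaled_curve \<xi>\<^sub>0 \<gamma> s t \<in> \<Omega>" if "s \<in> {0..1}" for s t
  proof -
    have "(1 - s) *\<^sub>R \<xi>\<^sub>0 + s *\<^sub>R \<gamma> t \<in> \<Omega>"
      using that assms(3,8,10) by (intro convexD) auto
    then show ?thesis
      by (simp add: scaled_curve_def algebra_simps)
  qed
  then have "K \<subseteq> \<Omega>"
    by (auto simp: K_def)
  have inj: "inj (\<lambda>i. \<mu> i \<xi>)" if "\<xi> \<in> \<Omega>" for \<xi>
    using assms(6) that by (auto simp: eigenvalue_labeling_def bij_betw_def)
  have \<mu>: "continuous_on \<Omega> (\<mu> i)" for i
    using assms(6) by (simp add: eigenvalue_labeling_def)
  have A: "continuous_on \<Omega> A"
    using assms(4) by (rule C_k_on_imp_continuous_on)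
  \<comment> \<open>The eigenvalues of the reduced resolvent at the \<open>j\<close>-th eigenvalue
    of \<open>A \<xi>\<close>.\<close>
  define f where "f i \<xi> = (if i = j then 0 else inverse (\<mu> j \<xi> - \<mu> i \<xi>))" for i \<xi>
  have "continuous_on \<Omega> (f i)" for i
    unfolding f_def
    using inj by (cases "i = j") (auto intro!: continuous_intros \<mu> simp: inj_def)
  then obtain T where T: "continuous_on \<Omega> T"
    "\<And>\<xi> i x. \<xi> \<in> \<Omega> \<Longrightarrow> A \<xi> *v x = \<mu> i \<xi> *s x \<Longrightarrow> T \<xi> *v x = f i \<xi> *s x"
    using continuous_on_interpolation[OF A \<mu> _ inj, of f] by blast
  obtain C\<^sub>T where C\<^sub>T: "\<And>\<xi>. \<xi> \<in> K \<Longrightarrow> norm (T \<xi>) \<le> C\<^sub>T" "C\<^sub>T > 0"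
  proof -
    have "bounded (T ` K)"
      using T(1) \<open>compact K\<close> \<open>K \<subseteq> \<Omega>\<close>
      by (meson compact_continuous_image compact_imp_bounded continuous_on_subset)
    then show thesis
      using that by (auto simp: bounded_pos)
  qed
  obtain C\<^sub>\<gamma> where C\<^sub>\<gamma>: "\<And>t. t \<in> {0..1} \<Longrightarrow> norm (\<gamma>' t) \<le> C\<^sub>\<gamma>" "C\<^sub>\<gamma> > 0"
  proof -
    have "bounded (\<gamma>' ` {0..1})"
      using \<gamma>'(2) by (meson compact_Icc compact_continuous_image compact_imp_bounded continuous_on_subset top_greatest)
    then show thesis
      using that unfolding bounded_pos by blast
  qed
  obtain C\<^sub>A where C\<^sub>A: "\<And>\<xi> h. \<xi> \<in> K \<Longrightarrow> norm (frechet_derivative A (at \<xi>) h) \<le> C\<^sub>A * norm h"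
    using C_k_on_frechet_derivative_bounded[OF assms(4)[unfolded k] \<open>compact K\<close> \<open>K \<subseteq> \<Omega>\<close>] by blast
  obtain C\<^sub>m where C\<^sub>m: "C\<^sub>m > 0" "\<And>M x. norm ((M :: complex^'n^'n) *v x) \<le> norm M * norm x * C\<^sub>m"
    using bounded_bilinear.pos_bounded[OF bounded_bilinear_matrix_vector_mult] by blast

  \<comment> \<open>\<open>C\<^sub>m\<close> enters twice, once for each matrix-vector product in
    \<open>T *v (B' *v x)\<close>; \<open>C\<^sub>A\<close> is taken in absolute value because its
    sign is not known.\<close>
  define C where "C = C\<^sub>T * (\<bar>C\<^sub>A\<bar> * C\<^sub>\<gamma> * C\<^sub>m) * C\<^sub>m"
  have phase: "norm (cis (\<alpha> j s) - 1) \<le> C * s" if s: "s \<in> {0<..1}" for s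
  proof (rule norm_cis_accrued_phase_minus_one_le)
    let ?c = "scaled_curve \<xi>\<^sub>0 \<gamma> s"
    show "accrues_phase A \<mu> ?c j (\<alpha> j s)"
      using assms(12) s by blast
    fix t :: real assume t: "t \<in> {0..1}"
    have cK: "?c t \<in> K" and c\<Omega>: "?c t \<in> \<Omega>"
      using K[of s t] s t \<open>K \<subseteq> \<Omega>\<close> by auto
    \<comment> \<open>This velocity is the source of the factor \<open>s\<close> in the final
      bound.\<close>
    have "(?c has_vector_derivative s *\<^sub>R \<gamma>' t) (at t)"
      unfolding scaled_curve_def using \<gamma>'(1) by (auto intro!: derivative_eq_intros)
    moreover have "(A has_derivative frechet_derivative A (at (?c t))) (at (?c t))"
      using assms(4) c\<Omega> by (simp add: k frechet_derivative_works)
    ultimately show "((\<lambda>t. A (?c t)) has_vector_derivative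
        frechet_derivative A (at (?c t)) (s *\<^sub>R \<gamma>' t)) (at t)"
      using vector_derivative_diff_chain_within[of ?c _ t UNIV A] has_derivative_at_withinI
      by (fastforce simp: o_def)
    show "\<mu> l (?c t) \<noteq> \<mu> j (?c t)" if "l \<noteq> j" for l
      using inj[OF c\<Omega>] that by (auto simp: inj_def)
    show "T (?c t) *v x = (if l = j then 0 else inverse (\<mu> j (?c t) - \<mu> l (?c t))) *s x"
      if "A (?c t) *v x = \<mu> l (?c t) *s x" for l x
      using T(2)[OF c\<Omega> that] by (simp add: f_def)
    show "norm (T (?c t) *v (frechet_derivative A (at (?c t)) (s *\<^sub>R \<gamma>' t) *v x)) \<le> C * s * norm x" for x
    proof -
      have "norm (frechet_derivative A (at (?c t)) (s *\<^sub>R \<gamma>' t)) \<le> C\<^sub>A * norm (s *\<^sub>R \<gamma>' t)"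
        by (rule C\<^sub>A[OF cK])
      also have "\<dots> \<le> \<bar>C\<^sub>A\<bar> * (s * C\<^sub>\<gamma>)"
        using s C\<^sub>\<gamma>(1)[OF t] by (intro mult_mono) auto
      finally have "norm (frechet_derivative A (at (?c t)) (s *\<^sub>R \<gamma>' t) *v x)
          \<le> \<bar>C\<^sub>A\<bar> * (s * C\<^sub>\<gamma>) * norm x * C\<^sub>m"
        using C\<^sub>m by (meson mult_right_mono norm_ge_zero order_trans less_imp_le)
      then have "norm (T (?c t)) * norm (frechet_derivative A (at (?c t)) (s *\<^sub>R \<gamma>' t) *v x) * C\<^sub>m
          \<le> C\<^sub>T * (\<bar>C\<^sub>A\<bar> * (s * C\<^sub>\<gamma>) * norm x * C\<^sub>m) * C\<^sub>m"
        using C\<^sub>T(1)[OF cK] C\<^sub>T(2) C\<^sub>m(1) C\<^sub>\<gamma>(2) s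
        by (intro mult_mono mult_nonneg_nonneg order_refl norm_ge_zero abs_ge_zero) simp_all
      with C\<^sub>m(2) show ?thesis
        unfolding C_def by (rule order_trans[THEN order_trans]) (simp add: mult_ac)
    qed
  qed

  \<comment> \<open>The principal representative has absolute value at most pi, so the chord length
    controls \<open>\<beta> s\<close> itself.\<close>
  define \<beta> where "\<beta> s = Arg (cis (\<alpha> j s))" for s
  have cis_\<beta>: "cis (\<beta> s) = cis (\<alpha> j s)" for s
    by (simp add: \<beta>_def cis_Arg sgn_eq)
  have "[\<beta> s = \<alpha> j s] (rmod (2 * pi))" for s
  proof -
    have "sin (\<alpha> j s) = sin (\<beta> s) \<and> cos (\<alpha> j s) = cos (\<beta> s)"
      using cis_\<beta>[of s] by (simp add: complex_eq_iff)
    then obtain n :: int where "\<alpha> j s = \<beta> s + 2 * pi * n"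
      unfolding sin_cos_eq_iff by blast
    then show ?thesis
      unfolding rcong_altdef by (intro exI[of _ n]) simp
  qed
  moreover have "\<beta> \<in> O[at_right 0](\<lambda>s. s)"
  proof (rule bigoI[of _ "2 * C"])
    have "norm (\<beta> s) \<le> 2 * C * norm s" if s: "s \<in> {0<..1}" for s
    proof -
      have "\<bar>\<beta> s\<bar> \<le> 2 * norm (cis (\<beta> s) - 1)"
        using Arg_bounded[of "cis (\<alpha> j s)"] by (intro abs_le_norm_cis_minus_one) (auto simp: \<beta>_def abs_le_iff)
      with phase[OF s] s show ?thesis
        by (simp add: cis_\<beta>)
    qed
    moreover have "eventually (\<lambda>s::real. s \<in> {0<..1}) (at_right 0)"
      by (auto simp: eventually_at_right_field intro!: exI[of _ 1])
    ultimately show "eventually (\<lambda>s. norm (\<beta> s) \<le> 2 * C * norm s) (at_right 0)"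
      by (rule eventually_mono[rotated])
  qed
  ultimately show "\<exists>\<beta>::real \<Rightarrow> real. (\<forall>s\<in>{0<..1}. [\<beta> s = \<alpha> j s] (rmod (2 * pi))) \<and> \<beta> \<in> O[at_right 0](\<lambda>s. s)"
    by blast
qed

end
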